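(* Let $n\ge 1$ and $1\le k\le n$ be integers. For $f\in\mathrm{RF}_n$, consider the longest sub-path of $P_f$ that contains $v_f$, contains no root vertex, and is such that none of the vertices on the sub-path has a sibling (this sub-path is empty, with $0$ vertices, if no such sub-path exists). Then $f\in\mathrm{RF}_{n,k}$ if and only if the number of vertices on this sub-path is $n-k$.
   Context: Parking functions. A parking function of length $n$ is an $n$-tuple $(a_1,\dots,a_n)$ of positive integers whose weakly increasing rearrangement $b_1\le\dots\le b_n$ satisfies $b_i\le i$ for all $i$; $\mathrm{PF}_n$ is the set of these. For $1<k\le n$, $\mathrm{PF}_{n,k}$ is the set of $a\in\mathrm{PF}_n$ such that $k$ is not an entry of $a$ but each of $k+1,\dots,n$ is an entry of $a$. The remaining elements of $\mathrm{PF}_n$ are the permutations of $(1,\dots,n)$. Forests. A rooted forest is a collection of trees, each with one vertex designated as its root. $\mathrm{RF}_n$ is the set of rooted forests on $n$ vertices whose vertices are labeled bijectively by $\{1,\dots,n\}$. For a vertex $v$, $h(v)$ is the distance from $v$ to the root of its tree; if $v,w$ are adjacent and $h(w)=h(v)+1$, then $v$ is the parent of $w$ and $w$ is a child of $v$. Two distinct vertices are siblings if they have the same parent or are both roots. $\eta(v)=i$ if $v$ has the $i$-th smallest label among the set consisting of $v$ and its siblings. $P_f$ is the unique path in $f$ from a root to a leaf (a vertex with no children) all of whose vertices $v$ satisfy $\eta(v)=1$, and $v_f$ is the leaf at its end. Bijection $\phi:\mathrm{RF}_n\to\mathrm{PF}_n$. Given $f\in\mathrm{RF}_n$, form a labeled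 binary rooted tree $b$ with the same labeled vertices: the root of $b$ is the root of $f$ with $\eta=1$; the left child in $b$ of a vertex $v$ is the sibling $w$ of $v$ in $f$ with $\eta(w)=\eta(v)+1$, if it exists; the right child in $b$ of $v$ is the child $x$ of $v$ in $f$ with $\eta(x)=1$, if it exists. Walk counterclockwise around the outside of $b$ starting at its root: at the first encounter with a vertex record an up step labeled by that vertex; if the vertex has a left child, record a right step when the vertex is encountered for the second time (after going around its left subtree); otherwise record the right step immediately after the up step. (Recursively, the word of a subtree with root $v$, left subtree $L$ and right subtree $R$ is $U_v\,D(L)\,\mathrm{(right)}\,D(R)$, where $D$ of the empty tree is empty.) This gives a labeled Dyck path, and $\phi(f)=(a_1,\dots,a_n)$ where $a_i$ is $1$ plus the number of right steps preceding the up step labeled $i$. The map $\phi$ is a bijection. For $1<k\le n$, $\mathrm{RF}_{n,k}=\phi^{-1}(\mathrm{PF}_{n,k})$, and $\mathrm{RF}_{n,1}$ is the set of $f\in\mathrm{RF}_n$ such that $\phi(f)$ is a permutation of $(1,\dots,n)$. *)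

theory Defs
  imports "HOL-Library.Multiset" "HOL-Library.Sublist" "HOL-Library.Tree"
begin

text \<open>An $n$-tuple $(a_1,\dots,a_n)$ is a list of length $n$; \<open>a ! i\<close> is $a_{i+1}$.\<close>

definition PF :: "nat \<Rightarrow> nat list set" where
  "PF n = {a. length a = n \<and> (\<forall>x \<in> set a. 1 \<le> x) \<and> (\<forall>i < n. sort a ! i \<le> i + 1)}"

text \<open>Used only for \<open>1 < k \<le> n\<close>.\<close>

definition PF_miss :: "nat \<Rightarrow> nat \<Rightarrow> nat list set" where
  "PF_miss n k = {a \<in> PF n. k \<notin> set a \<and> (\<forall>j \<in> {k+1..n}. j \<in> set a)}"

text \<open>Vertices are identified with their labels.\<close>

record rforest =
  verts :: "nat set"
  edges :: "nat set set"
  roots :: "nat set"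

definition adj :: "rforest \<Rightarrow> nat \<Rightarrow> nat \<Rightarrow> bool" where
  "adj f v w \<longleftrightarrow> {v, w} \<in> edges f"

definition is_cycle :: "rforest \<Rightarrow> nat list \<Rightarrow> bool" where
  "is_cycle f c \<longleftrightarrow>
     length c \<ge> 3 \<and> distinct c \<and> successively (adj f) c \<and> adj f (last c) (hd c)"

text \<open>
  A simple graph without cycles on \<open>{1..n}\<close>, each connected component of which
  contains exactly one root.
\<close>

definition RF :: "nat \<Rightarrow> rforest set" where
  "RF n = {f. verts f = {1..n}
            \<and> edges f \<subseteq> {e. e \<subseteq> verts f \<and> card e = 2}
            \<and> (\<nexists>c. is_cycle f c)
            \<and> roots f \<subseteq> verts f
            \<and> (\<forall>v \<in> verts f. \<exists>!r. r \<in> roots f \<and> (adj f)\<^sup>*\<^sup>* v r)}"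

text \<open>Only the root of the tree of \<open>v\<close> is reachable from \<open>v\<close>, so \<open>r\<close> below is that root.\<close>

definition root_dist :: "rforest \<Rightarrow> nat \<Rightarrow> nat" where
  "root_dist f v = (LEAST d. \<exists>r \<in> roots f. (adj f ^^ d) v r)"

definition parent :: "rforest \<Rightarrow> nat \<Rightarrow> nat \<Rightarrow> bool" where
  "parent f v w \<longleftrightarrow> adj f v w \<and> root_dist f w = root_dist f v + 1"

definition leaf :: "rforest \<Rightarrow> nat \<Rightarrow> bool" where
  "leaf f v \<longleftrightarrow> v \<in> verts f \<and> (\<nexists>w. parent f v w)"

definition siblings :: "rforest \<Rightarrow> nat \<Rightarrow> nat \<Rightarrow> bool" where
  "siblings f v w \<longleftrightarrow>
     v \<noteq> w \<and> ((\<exists>u. parent f u v \<and> parent f u w) \<or> (v \<in> roots f \<and> w \<in> roots f))"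

text \<open>The rank of the label of \<open>v\<close> among \<open>v\<close> and its siblings, counted from 1.\<close>

definition eta :: "rforest \<Rightarrow> nat \<Rightarrow> nat" where
  "eta f v = card {w. (w = v \<or> siblings f v w) \<and> w \<le> v}"

definition is_root_leaf_path :: "rforest \<Rightarrow> nat list \<Rightarrow> bool" where
  "is_root_leaf_path f p \<longleftrightarrow>
     p \<noteq> [] \<and> distinct p \<and> successively (adj f) p \<and> hd p \<in> roots f \<and> leaf f (last p)"

definition P_path :: "rforest \<Rightarrow> nat list" where
  "P_path f = (THE p. is_root_leaf_path f p \<and> (\<forall>v \<in> set p. eta f v = 1))"

definition v_leaf :: "rforest \<Rightarrow> nat" where
  "v_leaf f = last (P_path f)"

definition admissible_subpaths :: "rforest \<Rightarrow> nat list set" where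
  "admissible_subpaths f =
     {q. sublist q (P_path f) \<and> v_leaf f \<in> set q
         \<and> (\<forall>v \<in> set q. v \<notin> roots f \<and> (\<nexists>w. siblings f v w))}"

definition longest_subpath :: "rforest \<Rightarrow> nat list" where
  "longest_subpath f =
     (if admissible_subpaths f = {} then []
      else ARG_MAX length q. q \<in> admissible_subpaths f)"

definition left_child :: "rforest \<Rightarrow> nat \<Rightarrow> nat option" where
  "left_child f v =
     (if \<exists>w. siblings f v w \<and> eta f w = eta f v + 1
      then Some (THE w. siblings f v w \<and> eta f w = eta f v + 1) else None)"

definition right_child :: "rforest \<Rightarrow> nat \<Rightarrow> nat option" where
  "right_child f v =
     (if \<exists>x. parent f v x \<and> eta f x = 1
      then Some (THE x. parent f v x \<and> eta f x = 1) else None)"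

text \<open>
  \<open>bin_subtree f x t\<close>: the subtree of the binary tree rooted at the (possibly absent)
  vertex \<open>x\<close> is \<open>t\<close>. A relation, because the recursion need not terminate
  when \<open>f\<close> is not a forest.
\<close>

inductive bin_subtree :: "rforest \<Rightarrow> nat option \<Rightarrow> nat tree \<Rightarrow> bool" for f where
  absent: "bin_subtree f None \<langle>\<rangle>"
| vertex: "bin_subtree f (left_child f v) l \<Longrightarrow> bin_subtree f (right_child f v) r
           \<Longrightarrow> bin_subtree f (Some v) \<langle>l, v, r\<rangle>"

definition bin_root :: "rforest \<Rightarrow> nat" where
  "bin_root f = (THE r. r \<in> roots f \<and> eta f r = 1)"

definition bin_tree :: "rforest \<Rightarrow> nat tree" where
  "bin_tree f = (THE t. bin_subtree f (Some (bin_root f)) t)"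

datatype step = Up nat | RightStep

fun dyck_word :: "nat tree \<Rightarrow> step list" where
  "dyck_word \<langle>\<rangle> = []"
| "dyck_word \<langle>l, v, r\<rangle> = Up v # dyck_word l @ RightStep # dyck_word r"

definition phi :: "nat \<Rightarrow> rforest \<Rightarrow> nat list" where
  "phi n f = map (\<lambda>i. 1 + count_list (takeWhile (\<lambda>s. s \<noteq> Up i) (dyck_word (bin_tree f))) RightStep)
                 [1..<n+1]"

definition RF_class :: "nat \<Rightarrow> nat \<Rightarrow> rforest set" where
  "RF_class n k =
     (if k = 1 then {f \<in> RF n. mset (phi n f) = mset [1..<n+1]}
      else {f \<in> RF n. phi n f \<in> PF_miss n k})"

end

theory Submission
  imports Defs "HOL-Library.Transitive_Closure_Table"
begin

text \<open>
  The entries of \<open>\<phi>(f)\<close>, listed along the Dyck word, are weakly increasing and depend only on the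
  shape of the binary tree \<open>b\<close>. In that order the largest missing value is determined by how many
  up-right pairs end the word: \<open>\<phi>(f)\<close> misses \<open>k\<close> and contains \<open>k+1,\<dots>,n\<close> iff exactly \<open>n-k\<close> such pairs
  do, and \<open>\<phi>(f)\<close> is a permutation iff all \<open>n\<close> pairs do. These pairs are the vertices at the lower end
  of the right spine of \<open>b\<close> that have no left child. Finally, the right spine of \<open>b\<close> is \<open>P_f\<close>, and a vertex
  of rank \<open>1\<close> has a left child iff it has a sibling. If all \<open>n\<close> vertices qualify, the root is excluded from
  the sub-path, which then has \<open>n-1\<close> vertices, matching \<open>k=1\<close>.
\<close>

section \<open>Columns of the Dyck word of a binary tree\<close>

text \<open>For \<open>c = 1\<close> these are the entries of \<open>phi\<close>, read along the
  Dyck word instead of by label. The offset counts the right steps already taken: the word of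
  \<open>l\<close> contributes \<open>size l\<close>, and one more follows it.\<close>

fun columns :: "nat \<Rightarrow> 'a tree \<Rightarrow> nat list" where
  "columns c \<langle>\<rangle> = []"
| "columns c \<langle>l, v, r\<rangle> = c # columns c l @ columns (c + size l + 1) r"

fun spine :: "'a tree \<Rightarrow> 'a list" where
  "spine \<langle>\<rangle> = []"
| "spine \<langle>l, v, r\<rangle> = v # spine r"

text \<open>The largest \<open>m\<close> such that the word of the tree ends in \<open>m\<close> pairs of an up step and a right
  step.\<close>

fun tail_len :: "'a tree \<Rightarrow> nat" where
  "tail_len \<langle>\<rangle> = 0"
| "tail_len \<langle>l, v, r\<rangle> =
     (if tail_len r < size r then tail_len r else size r + (if l = \<langle>\<rangle> then 1 else 0))"

lemma length_columns [simp]: "length (columns c t) = size t"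
  by (induction t arbitrary: c) auto

lemma set_columns_subset: "set (columns c t) \<subseteq> {c..<c + size t}"
proof (induction t arbitrary: c)
  case (Node l v r)
  from Node.IH(1)[of c] Node.IH(2)[of "c + size l + 1"] show ?case by auto
qed simp

lemma sorted_columns: "sorted (columns c t)"
proof (induction t arbitrary: c)
  case (Node l v r)
  then show ?case
    using set_columns_subset[of c l] set_columns_subset[of "c + size l + 1" r]
    by (fastforce simp: sorted_append)
qed simp

text \<open>This is the Dyck condition: at most \<open>i\<close> right steps precede the up step
  with index \<open>i\<close>. For \<open>c = 1\<close> it is the bound required in
  \<open>PF\<close>.\<close>

lemma columns_nth_le: "i < size t \<Longrightarrow> columns c t ! i \<le> c + i"
proof (induction t arbitrary: c i)
  case (Node l v r)
  show ?case
  proof (cases i)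
    case (Suc j)
    show ?thesis
    proof (cases "j < size l")
      case True
      with Node.IH(1)[of j c] Suc show ?thesis by (simp add: nth_append)
    next
      case False
      with Node.IH(2)[of "j - size l" "c + size l + 1"] Node.prems Suc show ?thesis
        by (simp add: nth_append)
    qed
  qed simp
qed simp

lemma tail_len_le_size: "tail_len t \<le> size t"
  by (induction t) auto

text \<open>The columns of \<open>l\<close> stay below \<open>c + size l\<close> and those of
  \<open>r\<close> start just above it, so \<open>c + size l\<close> can only be the column of the
  root, which happens iff \<open>l\<close> is empty. A gap in \<open>r\<close> lies higher and takes
  precedence; if \<open>r\<close> has none, \<open>c + size l\<close> is the largest gap or there is
  no gap.\<close>

lemma set_columns_eq_iff: "set (columns c t) = {c..<c + size t} \<longleftrightarrow> tail_len t = size t"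
  and largest_missing_column: "tail_len t < size t \<Longrightarrow>
    c + size t - 1 - tail_len t \<notin> set (columns c t) \<and>
    {c + size t - tail_len t..<c + size t} \<subseteq> set (columns c t)"
proof -
  \<comment> \<open>Both claims need each other in the induction. Only one direction of the
    equivalence is carried along; the other follows from the missing column.\<close>
  have *: "(tail_len t = size t \<longrightarrow> set (columns c t) = {c..<c + size t}) \<and>
     (tail_len t < size t \<longrightarrow> c + size t - 1 - tail_len t \<notin> set (columns c t) \<and>
       {c + size t - tail_len t..<c + size t} \<subseteq> set (columns c t))" for c
  proof (induction t arbitrary: c)
    case (Node l v r)
    let ?c = "c + size l + 1"
    have sl: "set (columns c l) \<subseteq> {c..<c + size l}"
      and sr: "set (columns ?c r) \<subseteq> {?c..<?c + size r}"
      by (rule set_columns_subset)+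
    show ?case
    proof (cases "tail_len r < size r")
      case True
      then have "?c + size r - 1 - tail_len r \<notin> set (columns ?c r)"
        and "{?c + size r - tail_len r..<?c + size r} \<subseteq> set (columns ?c r)"
        using Node.IH(2)[of ?c] by blast+
      moreover have "?c + size r - 1 - tail_len r \<notin> set (columns c l)"
        using sl True by (force dest!: subsetD)
      ultimately show ?thesis using True by (auto simp: add.assoc)
    next
      case False
      then have "tail_len r = size r" using tail_len_le_size[of r] by simp
      then have r: "set (columns ?c r) = {?c..<?c + size r}" using Node.IH(2)[of ?c] by blast
      show ?thesis
      proof (cases "l = \<langle>\<rangle>")
        case True
        then show ?thesis using r False by auto
      next
        case nl: False
        then have "0 < size l" by (cases l) auto
        then show ?thesis using r False nl sl by auto
      qed
    qed
  qed simp
  show "set (columns c t) = {c..<c + size t} \<longleftrightarrow> tail_len t = size t"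
  proof
    assume eq: "set (columns c t) = {c..<c + size t}"
    show "tail_len t = size t"
    proof (rule ccontr)
      assume "tail_len t \<noteq> size t"
      then have "tail_len t < size t" using tail_len_le_size[of t] by simp
      moreover from this have "c + size t - 1 - tail_len t \<in> {c..<c + size t}" by auto
      ultimately show False using * eq by blast
    qed
  qed (use * in blast)
  show "tail_len t < size t \<Longrightarrow>
    c + size t - 1 - tail_len t \<notin> set (columns c t) \<and>
    {c + size t - tail_len t..<c + size t} \<subseteq> set (columns c t)"
    using * by blast
qed

section \<open>From the Dyck word to the classes of parking functions\<close>

lemma Up_in_dyck_word_iff [simp]: "Up i \<in> set (dyck_word t) \<longleftrightarrow> i \<in> set_tree t"
  by (induction t) auto

lemma count_RightStep_dyck_word [simp]: "count_list (dyck_word t) RightStep = size t"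
  by (induction t) auto

text \<open>Distinct labels make the cut at \<open>Up i\<close> fall in the right subword. For
  \<open>i\<close> in \<open>r\<close> it passes the whole word of \<open>l\<close> and the right
  step after it, hence the shift by \<open>size l + 1\<close>.\<close>

lemma map_count_takeWhile_dyck_word:
  assumes "distinct (preorder t)"
  shows "map (\<lambda>i. c + count_list (takeWhile (\<lambda>s. s \<noteq> Up i) (dyck_word t)) RightStep) (preorder t)
    = columns c t"
  using assms
proof (induction t arbitrary: c)
  case (Node l v r)
  have v: "v \<notin> set_tree l" "v \<notin> set_tree r" and lr: "set_tree l \<inter> set_tree r = {}"
    using Node.prems by auto
  let ?tw = "\<lambda>t i. count_list (takeWhile (\<lambda>s. s \<noteq> Up i) (dyck_word t)) RightStep"
  have "?tw \<langle>l, v, r\<rangle> i = ?tw l i" if "i \<in> set_tree l" for i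
    using that v takeWhile_append1[of "Up i" "dyck_word l" "\<lambda>s. s \<noteq> Up i"] by auto
  moreover have "?tw \<langle>l, v, r\<rangle> i = size l + 1 + ?tw r i" if "i \<in> set_tree r" for i
  proof -
    have "\<forall>s\<in>set (dyck_word l). s \<noteq> Up i" "i \<noteq> v" using that lr v by auto
    then show ?thesis using takeWhile_append2[of "dyck_word l" "\<lambda>s. s \<noteq> Up i"] by auto
  qed
  moreover have "?tw \<langle>l, v, r\<rangle> v = 0" by simp
  ultimately have "map (\<lambda>i. c + ?tw \<langle>l, v, r\<rangle> i) (preorder l) = map (\<lambda>i. c + ?tw l i) (preorder l)"
    and "map (\<lambda>i. c + ?tw \<langle>l, v, r\<rangle> i) (preorder r)
      = map (\<lambda>i. (c + size l + 1) + ?tw r i) (preorder r)"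
    and "c + ?tw \<langle>l, v, r\<rangle> v = c"
    by (auto simp del: dyck_word.simps)
  moreover have "map (\<lambda>i. c + ?tw l i) (preorder l) = columns c l"
    and "map (\<lambda>i. (c + size l + 1) + ?tw r i) (preorder r) = columns (c + size l + 1) r"
    using Node.IH(1)[of c] Node.IH(2)[of "c + size l + 1"] Node.prems
    by (simp_all only: preorder.simps distinct.simps distinct_append)
  ultimately show ?case
    unfolding preorder.simps columns.simps list.map map_append by (simp only:)
qed simp

lemma mset_phi:
  assumes "distinct (preorder (bin_tree f))" "set_tree (bin_tree f) = {1..n}"
  shows "mset (phi n f) = mset (columns 1 (bin_tree f))"
proof -
  have "mset [1..<n+1] = mset (preorder (bin_tree f))"
    using set_eq_iff_mset_eq_distinct[of "[1..<n+1]" "preorder (bin_tree f)"] assms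
    by (simp add: atLeastLessThanSuc_atLeastAtMost del: upt_Suc mset_upt)
  then show ?thesis
    unfolding phi_def map_count_takeWhile_dyck_word[OF assms(1), symmetric] mset_map by (rule arg_cong)
qed

lemma RF_class_iff:
  assumes "distinct (preorder (bin_tree f))" "set_tree (bin_tree f) = {1..n}"
    and "f \<in> RF n" "1 \<le> n" "1 \<le> k" "k \<le> n"
  shows "f \<in> RF_class n k \<longleftrightarrow>
    (if k = 1 then tail_len (bin_tree f) = n else tail_len (bin_tree f) = n - k)"
proof -
  define t where "t = bin_tree f"
  have n: "size t = n"
    using assms(1,2) distinct_card[of "preorder t"] by (simp add: t_def)
  have ms: "mset (phi n f) = mset (columns 1 t)"
    unfolding t_def by (rule mset_phi) fact+
  then have st: "set (phi n f) = set (columns 1 t)" by (metis set_mset_mset)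
  have lt: "length (phi n f) = n" by (simp add: phi_def)
  have sort: "sort (phi n f) = columns 1 t"
    by (rule properties_for_sort) (simp_all add: ms sorted_columns)
  have PF: "phi n f \<in> PF n"
    unfolding PF_def using columns_nth_le[of _ t 1] set_columns_subset[of 1 t]
    by (auto simp: sort n lt st)
  show ?thesis
  proof (cases "k = 1")
    case True
    \<comment> \<open>The \<open>n\<close> columns take \<open>n\<close> values only if they are
      pairwise distinct.\<close>
    have "mset (phi n f) = mset [1..<n+1] \<longleftrightarrow> set (columns 1 t) = {1..<1 + size t}"
    proof
      assume "mset (phi n f) = mset [1..<n+1]"
      then show "set (columns 1 t) = {1..<1 + size t}"
        using ms n by (metis add.commute set_mset_mset set_upt)
    next
      assume s: "set (columns 1 t) = {1..<1 + size t}"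
      then have "distinct (columns 1 t)" by (simp add: card_distinct)
      then show "mset (phi n f) = mset [1..<n+1]"
        using ms s n set_eq_iff_mset_eq_distinct[of "columns 1 t" "[1..<n+1]"]
        by (simp del: upt_Suc mset_upt)
    qed
    then show ?thesis
      using True assms(3) set_columns_eq_iff[of 1 t] n by (simp add: RF_class_def t_def)
  next
    case False
    have miss: "f \<in> RF_class n k \<longleftrightarrow> k \<notin> set (columns 1 t) \<and> {k+1..n} \<subseteq> set (columns 1 t)"
      using False assms(3) PF st by (simp add: RF_class_def PF_miss_def subset_eq)
    show ?thesis
    proof (cases "tail_len t = n")
      case True
      then have "k \<in> set (columns 1 t)" using set_columns_eq_iff[of 1 t] n assms(5,6) by auto
      then show ?thesis using miss False True assms(5,6) by (simp add: t_def)
    next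
      case nt: False
      then have less: "tail_len t < n" using tail_len_le_size[of t] n by simp
      then have a: "n - tail_len t \<notin> set (columns 1 t)"
        and b: "{n - tail_len t + 1..n} \<subseteq> set (columns 1 t)"
        using largest_missing_column[of t 1] n by (auto simp: Suc_diff_le atLeastLessThanSuc_atLeastAtMost)
      \<comment> \<open>Both \<open>k\<close> and \<open>n - tail_len t\<close> would be the largest
        missing value; if they differed, the larger would be both missing and present.\<close>
      have "f \<in> RF_class n k \<longleftrightarrow> k = n - tail_len t"
      proof
        assume "f \<in> RF_class n k"
        then have k: "k \<notin> set (columns 1 t)" "{k+1..n} \<subseteq> set (columns 1 t)" using miss by auto
        show "k = n - tail_len t"
        proof (rule ccontr)
          assume "k \<noteq> n - tail_len t"
          then consider "k + 1 \<le> n - tail_len t" | "n - tail_len t + 1 \<le> k" by linarith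
          then show False
          proof cases
            case 1
            then have "n - tail_len t \<in> {k+1..n}" by simp
            then show False using a k by blast
          next
            case 2
            then have "k \<in> {n - tail_len t + 1..n}" using assms(6) by simp
            then show False using b k by blast
          qed
        qed
      qed (use miss a b in simp)
      then show ?thesis using False less assms(6) unfolding t_def by simp linarith
    qed
  qed
qed

text \<open>The largest missing column would be \<open>1\<close>, but this is the column of the
  root. Hence a sub-path of \<open>n - 1\<close> vertices can only come from a full tail.\<close>

lemma tail_len_neq_size_minus_one:
  assumes "t \<noteq> \<langle>\<rangle>"
  shows "tail_len t \<noteq> size t - 1"
proof
  assume eq: "tail_len t = size t - 1"
  from assms have "size t > 0" by (cases t) auto
  with eq have "1 \<notin> set (columns 1 t)" using largest_missing_column[of t 1] by auto
  then show False using assms by (cases t) auto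
qed

section \<open>Rooted forests\<close>

lemma successively_if_rtrancl_path: "rtrancl_path r x xs y \<Longrightarrow> successively r (x # xs)"
  by (induction rule: rtrancl_path.induct) auto

lemma last_if_rtrancl_path: "rtrancl_path r x xs y \<Longrightarrow> last (x # xs) = y"
  by (induction rule: rtrancl_path.induct) auto

text \<open>A walk from \<open>v\<close> to \<open>w\<close> that avoids the edge is shortened to a
  path, which the edge closes to a cycle. The path has a third vertex, since its only step would
  otherwise be the edge itself.\<close>

lemma cycle_if_edge_not_bridge:
  assumes "adj f w v" "v \<noteq> w" "(\<lambda>x y. adj f x y \<and> {x, y} \<noteq> {v, w})\<^sup>*\<^sup>* v w"
  shows "\<exists>c. is_cycle f c"
proof -
  let ?r = "\<lambda>x y. adj f x y \<and> {x, y} \<noteq> {v, w}"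
  obtain xs where xs: "rtrancl_path ?r v xs w" "distinct (v # xs)"
    using assms(3) unfolding rtranclp_eq_rtrancl_path by (blast elim: rtrancl_path_distinct)
  have last: "last (v # xs) = w" and succ: "successively ?r (v # xs)"
    by (rule last_if_rtrancl_path[OF xs(1)], rule successively_if_rtrancl_path[OF xs(1)])
  have "length (v # xs) \<ge> 3"
  proof (rule ccontr)
    assume "\<not> length (v # xs) \<ge> 3"
    then have "xs = [] \<or> (\<exists>x. xs = [x])" by (cases xs rule: remdups_adj.cases) auto
    then show False using last succ assms(2) by auto
  qed
  moreover have "successively (adj f) (v # xs)"
    using succ by (rule successively_mono) simp
  ultimately have "is_cycle f (v # xs)"
    using xs(2) last assms(1) by (simp add: is_cycle_def)
  then show ?thesis ..
qed

locale rooted_forest =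
  fixes n :: nat and f :: rforest
  assumes RF: "f \<in> RF n"
begin

lemma verts: "verts f = {1..n}"
  using RF by (simp add: RF_def)

lemma roots_subset: "roots f \<subseteq> {1..n}"
  and acyclic: "\<not> is_cycle f c"
  and ex1_root: "v \<in> {1..n} \<Longrightarrow> \<exists>!r. r \<in> roots f \<and> (adj f)\<^sup>*\<^sup>* v r"
  using RF by (simp_all add: RF_def verts)

lemma finite_roots: "finite (roots f)"
  using roots_subset finite_subset by blast

lemma adj_sym: "adj f v w \<Longrightarrow> adj f w v"
  by (simp add: adj_def insert_commute)

lemma adjD:
  assumes "adj f v w"
  shows "v \<in> {1..n}" "w \<in> {1..n}" "v \<noteq> w"
proof -
  have "{v, w} \<subseteq> {1..n}" "card {v, w} = 2"
    using assms RF by (auto simp: adj_def RF_def)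
  then show "v \<in> {1..n}" "w \<in> {1..n}" "v \<noteq> w" by auto
qed

lemma root_dist_attained:
  assumes "v \<in> {1..n}"
  shows "\<exists>r \<in> roots f. (adj f ^^ root_dist f v) v r"
proof -
  obtain r d where "r \<in> roots f" "(adj f ^^ d) v r"
    using ex1_root[OF assms] rtranclp_imp_relpowp by metis
  then have "\<exists>d. \<exists>r \<in> roots f. (adj f ^^ d) v r" by blast
  then show ?thesis unfolding root_dist_def by (rule LeastI_ex)
qed

lemma root_dist_le: "r \<in> roots f \<Longrightarrow> (adj f ^^ d) v r \<Longrightarrow> root_dist f v \<le> d"
  unfolding root_dist_def by (rule Least_le) blast

lemma root_dist_root [simp]: "r \<in> roots f \<Longrightarrow> root_dist f r = 0"
  using root_dist_le[of r 0 r] by simp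

lemma not_parent_root: "r \<in> roots f \<Longrightarrow> \<not> parent f u r"
  by (simp add: parent_def)

text \<open>The second vertex of a shortest walk from \<open>v\<close> to a root is exactly one step
  closer to the roots.\<close>

lemma ex_parent:
  assumes "v \<in> {1..n}" "v \<notin> roots f"
  shows "\<exists>u. parent f u v"
proof -
  obtain r where r: "r \<in> roots f" "(adj f ^^ root_dist f v) v r"
    using root_dist_attained[OF assms(1)] by blast
  have "root_dist f v \<noteq> 0" using r assms(2) by (metis relpowp_0_E)
  then obtain d where d: "root_dist f v = Suc d" using not0_implies_Suc by blast
  with r(2) obtain u where u: "adj f v u" "(adj f ^^ d) u r" using relpowp_Suc_D2 by metis
  have "u \<in> {1..n}" using adjD u(1) by blast
  then obtain r' where "r' \<in> roots f" "(adj f ^^ root_dist f u) u r'"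
    using root_dist_attained by blast
  then have "root_dist f v \<le> Suc (root_dist f u)"
    using root_dist_le relpowp_Suc_I2[where P = "adj f", OF u(1)] by blast
  moreover have "root_dist f u \<le> d" using root_dist_le r(1) u(2) by blast
  ultimately show ?thesis using d adj_sym[OF u(1)] by (auto simp: parent_def)
qed

text \<open>A choice, because uniqueness of parents is only derived afterwards, from
  \<open>adj_imp_par\<close>.\<close>

definition par :: "nat \<Rightarrow> nat" where
  "par v = (SOME u. parent f u v)"

lemma parent_par: "v \<in> {1..n} \<Longrightarrow> v \<notin> roots f \<Longrightarrow> parent f (par v) v"
  unfolding par_def using ex_parent by (rule someI_ex)

definition par_step :: "nat \<Rightarrow> nat \<Rightarrow> bool" where
  "par_step v u \<longleftrightarrow> v \<in> {1..n} \<and> v \<notin> roots f \<and> u = par v"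

lemma par_steps_to_root:
  assumes "v \<in> {1..n}"
  shows "\<exists>r \<in> roots f. par_step\<^sup>*\<^sup>* v r"
  using assms
proof (induction "root_dist f v" arbitrary: v rule: less_induct)
  case less
  show ?case
  proof (cases "v \<in> roots f")
    case False
    then have "parent f (par v) v" using parent_par less.prems by blast
    then have "root_dist f (par v) < root_dist f v" "par v \<in> {1..n}"
      using adjD by (auto simp: parent_def)
    then obtain r where "r \<in> roots f" "par_step\<^sup>*\<^sup>* (par v) r" using less.hyps by blast
    moreover have "par_step v (par v)" using False less.prems by (simp add: par_step_def)
    ultimately show ?thesis by (meson converse_rtranclp_into_rtranclp)
  qed blast
qed

text \<open>Otherwise the walks from \<open>v\<close> and \<open>w\<close> up to their common root avoid the edge between them, which
  then lies on a cycle.\<close>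

lemma adj_imp_par:
  assumes "adj f v w"
  shows "par_step v w \<or> par_step w v"
proof (rule ccontr)
  assume no: "\<not> ?thesis"
  let ?e = "\<lambda>x y. adj f x y \<and> {x, y} \<noteq> {v, w}"
  have vw: "v \<in> {1..n}" "w \<in> {1..n}" "v \<noteq> w" using adjD assms by auto
  have "par_step x y \<Longrightarrow> adj f x y" for x y
    using parent_par adj_sym by (auto simp: par_step_def parent_def)
  then have sub: "par_step x y \<Longrightarrow> ?e x y" for x y
    using no by (auto simp: doubleton_eq_iff)
  obtain r where r: "r \<in> roots f" "par_step\<^sup>*\<^sup>* v r" using par_steps_to_root vw by blast
  obtain s where s: "s \<in> roots f" "par_step\<^sup>*\<^sup>* w s" using par_steps_to_root vw by blast
  have er: "?e\<^sup>*\<^sup>* v r" "?e\<^sup>*\<^sup>* w s"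
    using r(2) s(2) sub by (auto elim: mono_rtranclp[rule_format, rotated])
  then have "(adj f)\<^sup>*\<^sup>* v r" "(adj f)\<^sup>*\<^sup>* w s"
    by (auto elim: mono_rtranclp[rule_format, rotated])
  \<comment> \<open>Putting the edge in front of the walk from \<open>w\<close> makes both roots
    reachable from \<open>v\<close>, so they coincide.\<close>
  then have "(adj f)\<^sup>*\<^sup>* v r" "(adj f)\<^sup>*\<^sup>* v s"
    using assms by (auto intro: converse_rtranclp_into_rtranclp)
  then have "s = r" using ex1_root[OF vw(1)] r(1) s(1) by blast
  have "symp ?e" by (auto simp: symp_def insert_commute intro: adj_sym)
  then have "symp ?e\<^sup>*\<^sup>*" by (rule symp_rtranclp)
  then have "?e\<^sup>*\<^sup>* r w" using er(2) \<open>s = r\<close> by (auto dest: sympD)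
  with er(1) have "?e\<^sup>*\<^sup>* v w" by (rule rtranclp_trans)
  then show False
    using cycle_if_edge_not_bridge[OF adj_sym[OF assms] vw(3)] acyclic by blast
qed

text \<open>Here acyclicity turns the relation given by distances into a function: every edge joins
  a vertex to its chosen parent, and the distances fix which end is the parent.\<close>

lemma parent_iff: "parent f u w \<longleftrightarrow> par_step w u"
proof
  assume p: "parent f u w"
  then have "par_step u w \<or> par_step w u" using adj_imp_par by (auto simp: parent_def)
  then show "par_step w u"
  proof
    assume "par_step u w"
    then have "parent f w u" using parent_par by (auto simp: par_step_def)
    then show ?thesis using p by (simp add: parent_def)
  qed
qed (use parent_par in \<open>auto simp: par_step_def\<close>)

lemma adj_cases: "adj f v w \<Longrightarrow> parent f v w \<or> parent f w v"
  using adj_imp_par parent_iff by blast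

lemma parent_unique: "parent f u w \<Longrightarrow> parent f u' w \<Longrightarrow> u = u'"
  by (simp add: parent_iff par_step_def)

lemma parentD:
  assumes "parent f u w"
  shows "u \<in> {1..n}" "w \<in> {1..n}" "w \<notin> roots f" "root_dist f w = root_dist f u + 1"
  using assms adjD[of u w] not_parent_root unfolding parent_def by blast+

lemma root_dist_descendant: "(parent f)\<^sup>*\<^sup>* u w \<Longrightarrow> root_dist f u \<le> root_dist f w"
  by (induction rule: rtranclp_induct) (simp_all add: parent_def)

lemma descendant_of_root:
  assumes "v \<in> {1..n}"
  shows "\<exists>r \<in> roots f. (parent f)\<^sup>*\<^sup>* r v"
proof -
  obtain r where "r \<in> roots f" "par_step\<^sup>*\<^sup>* v r" using par_steps_to_root assms by blast
  moreover have "parent f = par_step\<inverse>\<inverse>" by (auto simp: fun_eq_iff parent_iff)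
  ultimately show ?thesis by (auto simp: rtranclp_conversep)
qed

text \<open>Read upwards from \<open>x\<close>, the two chains agree as long as both continue, since
  parents are unique. Equal distance makes them stop together. This yields the disjointness of the
  subtrees of the binary tree.\<close>

lemma common_descendant:
  assumes "(parent f)\<^sup>*\<^sup>* u x" "(parent f)\<^sup>*\<^sup>* w x" "root_dist f u = root_dist f w"
  shows "u = w"
  using assms
proof (induction rule: rtranclp_induct)
  case base
  show ?case using base
  proof (cases rule: rtranclp.cases)
    case (rtrancl_into_rtrancl y)
    then show ?thesis using root_dist_descendant[of w y] parentD(4)[of y u] base by simp
  qed simp
next
  case (step y z)
  from step.prems(1) show ?case
  proof (cases rule: rtranclp.cases)
    case rtrancl_refl
    then show ?thesis
      using root_dist_descendant[of u y] parentD(4)[OF step.hyps(2)] step by simp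
  next
    case (rtrancl_into_rtrancl y')
    then show ?thesis using parent_unique[OF step.hyps(2)] step by blast
  qed
qed

section \<open>Siblings, their ranks, and the children in the binary tree\<close>

definition sibship :: "nat \<Rightarrow> nat set" where
  "sibship v = {w. w = v \<or> siblings f v w}"

lemma sibship_self [simp]: "v \<in> sibship v"
  by (simp add: sibship_def)

lemma sibship_root: "r \<in> roots f \<Longrightarrow> sibship r = roots f"
  unfolding sibship_def siblings_def using not_parent_root by blast

lemma sibship_child:
  assumes "parent f u v"
  shows "sibship v = {w. parent f u w}"
proof -
  have "v \<notin> roots f" using assms not_parent_root by blast
  then show ?thesis using assms parent_unique[OF assms]
    unfolding sibship_def siblings_def by blast
qed

lemma sibship_eq:
  assumes "w \<in> sibship v"
  shows "sibship w = sibship v"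
proof -
  consider "w = v" | u where "parent f u v" "parent f u w" | "v \<in> roots f" "w \<in> roots f"
    using assms unfolding sibship_def siblings_def by blast
  then show ?thesis by cases (simp_all add: sibship_root sibship_child)
qed

lemma root_dist_sibship: "w \<in> sibship v \<Longrightarrow> root_dist f w = root_dist f v"
  unfolding sibship_def siblings_def using parentD(4) root_dist_root by (smt (verit) CollectD)

lemma sibship_subset: "v \<in> {1..n} \<Longrightarrow> sibship v \<subseteq> {1..n}"
  using roots_subset parentD(2) unfolding sibship_def siblings_def by blast

lemma finite_sibship: "v \<in> {1..n} \<Longrightarrow> finite (sibship v)"
  using sibship_subset finite_subset by blast

lemma siblings_iff: "siblings f v w \<longleftrightarrow> w \<in> sibship v \<and> w \<noteq> v"
  by (auto simp: sibship_def siblings_def)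

lemma eta_eq: "eta f v = card {w \<in> sibship v. w \<le> v}"
  by (simp add: eta_def sibship_def)

lemma eta_eq_1_iff:
  assumes "v \<in> {1..n}"
  shows "eta f v = 1 \<longleftrightarrow> v = Min (sibship v)"
proof
  assume "eta f v = 1"
  then obtain x where x: "{w \<in> sibship v. w \<le> v} = {x}"
    unfolding eta_eq by (auto simp: card_1_singleton_iff)
  moreover from this have "x = v" by auto
  ultimately have "v \<le> w" if "w \<in> sibship v" for w using that by (cases "w \<le> v") auto
  then show "v = Min (sibship v)" using finite_sibship[OF assms] by (auto intro: Min_eqI[symmetric])
next
  assume "v = Min (sibship v)"
  then have "v \<le> w" if "w \<in> sibship v" for w using that finite_sibship[OF assms] by (metis Min_le)
  then have "{w \<in> sibship v. w \<le> v} = {v}" by (auto intro: order_antisym)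
  then show "eta f v = 1" by (simp add: eta_eq)
qed

text \<open>For \<open>v < w\<close> the ranks differ by the number of members of the sibship in the
  interval from \<open>v\<close> (excluded) to \<open>w\<close> (included). It is \<open>1\<close>
  iff \<open>w\<close> is the only one.\<close>

lemma eta_succ_iff:
  assumes v: "v \<in> {1..n}" and w: "w \<in> sibship v"
  shows "eta f w = eta f v + 1 \<longleftrightarrow> v < w \<and> (\<forall>x \<in> sibship v. v < x \<longrightarrow> w \<le> x)"
proof -
  let ?S = "sibship v"
  have fin: "finite ?S" using finite_sibship v by blast
  have ew: "eta f w = card {x \<in> ?S. x \<le> w}" using sibship_eq[OF w] by (simp add: eta_eq)
  show ?thesis
  proof (cases "v < w")
    case True
    then have "{x \<in> ?S. x \<le> w} = {x \<in> ?S. x \<le> v} \<union> {x \<in> ?S. v < x \<and> x \<le> w}" by auto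
    then have "eta f w = eta f v + card {x \<in> ?S. v < x \<and> x \<le> w}"
      unfolding ew eta_eq[of v] using fin by (subst card_Un_disjoint[symmetric]) auto
    moreover have "card {x \<in> ?S. v < x \<and> x \<le> w} = 1 \<longleftrightarrow> (\<forall>x \<in> ?S. v < x \<longrightarrow> w \<le> x)"
    proof
      assume "card {x \<in> ?S. v < x \<and> x \<le> w} = 1"
      then obtain y where "{x \<in> ?S. v < x \<and> x \<le> w} = {y}" by (auto simp: card_1_singleton_iff)
      moreover have "w \<in> {x \<in> ?S. v < x \<and> x \<le> w}" using True w by simp
      ultimately have "{x \<in> ?S. v < x \<and> x \<le> w} = {w}" by auto
      then show "\<forall>x \<in> ?S. v < x \<longrightarrow> w \<le> x" by (metis (mono_tags, lifting) CollectI linear singletonD)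
    next
      assume "\<forall>x \<in> ?S. v < x \<longrightarrow> w \<le> x"
      then have "{x \<in> ?S. v < x \<and> x \<le> w} = {w}" using True w by (auto intro: order_antisym)
      then show "card {x \<in> ?S. v < x \<and> x \<le> w} = 1" by simp
    qed
    ultimately show ?thesis using True by simp
  next
    case False
    then have "{x \<in> ?S. x \<le> w} \<subseteq> {x \<in> ?S. x \<le> v}" by auto
    then have "eta f w \<le> eta f v" unfolding ew eta_eq[of v] using fin by (intro card_mono) auto
    then show ?thesis using False by simp
  qed
qed

lemma left_child_eq:
  assumes "v \<in> {1..n}"
  shows "left_child f v = (if {w \<in> sibship v. v < w} = {} then None
     else Some (Min {w \<in> sibship v. v < w}))"
proof -
  let ?N = "{w \<in> sibship v. v < w}"
  have fin: "finite ?N" using finite_sibship assms by simp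
  have iff: "siblings f v w \<and> eta f w = eta f v + 1 \<longleftrightarrow> w \<in> ?N \<and> (\<forall>x \<in> ?N. w \<le> x)" for w
    using eta_succ_iff[OF assms] by (auto simp: siblings_iff)
  show ?thesis
  proof (cases "?N = {}")
    case True
    then show ?thesis using iff by (auto simp: left_child_def)
  next
    case False
    have "siblings f v w \<and> eta f w = eta f v + 1 \<longleftrightarrow> Min ?N = w" for w
      by (simp only: iff Min_eq_iff[OF fin False])
    then show ?thesis using False by (simp add: left_child_def)
  qed
qed

lemma right_child_eq:
  "right_child f v = (if {w. parent f v w} = {} then None else Some (Min {w. parent f v w}))"
proof -
  let ?N = "{w. parent f v w}"
  have fin: "finite ?N" using parentD(2) by (auto intro: finite_subset[of _ "{1..n}"])
  have iff: "parent f v w \<and> eta f w = 1 \<longleftrightarrow> w \<in> ?N \<and> w = Min ?N" for w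
    using eta_eq_1_iff[of w] sibship_child[of v w] parentD(2)[of v w] by auto
  show ?thesis
  proof (cases "?N = {}")
    case True
    then show ?thesis by (auto simp: right_child_def)
  next
    case False
    then have "Min ?N \<in> ?N" using fin by (rule Min_in[rotated])
    then have "parent f v w \<and> eta f w = 1 \<longleftrightarrow> w = Min ?N" for w
      unfolding iff by auto
    then show ?thesis using False by (simp add: right_child_def)
  qed
qed

end

section \<open>The binary tree of a forest and its right spine\<close>

lemma set_spine_subset: "set (spine t) \<subseteq> set_tree t"
  by (induction t) auto

lemma distinct_spine: "distinct (preorder t) \<Longrightarrow> distinct (spine t)"
proof (induction t)
  case (Node l v r)
  then show ?case using set_spine_subset[of r] by auto
qed simp

text \<open>Together with \<open>ex_bin_subtree\<close> this justifies the definite description in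
  \<open>bin_tree\<close>.\<close>

lemma bin_subtree_unique: "bin_subtree f x t \<Longrightarrow> bin_subtree f x t' \<Longrightarrow> t = t'"
proof (induction arbitrary: t' rule: bin_subtree.induct)
  case absent
  then show ?case by (auto elim: bin_subtree.cases)
next
  case (vertex v l r)
  from vertex.prems obtain l' r' where "t' = \<langle>l', v, r'\<rangle>"
    "bin_subtree f (left_child f v) l'" "bin_subtree f (right_child f v) r'"
    by (auto elim: bin_subtree.cases)
  then show ?case using vertex.IH by simp
qed

lemma bin_subtree_Leaf_iff: "bin_subtree f x t \<Longrightarrow> t = \<langle>\<rangle> \<longleftrightarrow> x = None"
  by (auto elim: bin_subtree.cases)

text \<open>In a distinct list a sublist containing the last element is a suffix, and the suffixes
  on which \<open>P\<close> holds are the reversed prefixes of \<open>rev p\<close> on which it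
  holds.\<close>

lemma length_longest_sublist_to_last:
  fixes p :: "'a list" and P :: "'a \<Rightarrow> bool"
  assumes "p \<noteq> []" "distinct p"
  defines "S \<equiv> {q. sublist q p \<and> last p \<in> set q \<and> (\<forall>v \<in> set q. P v)}"
  shows "length (if S = {} then [] else ARG_MAX length q. q \<in> S) = length (takeWhile P (rev p))"
proof -
  let ?q0 = "rev (takeWhile P (rev p))"
  have bound: "length q \<le> length ?q0" if "q \<in> S" for q
  proof -
    from that obtain a b where p: "p = a @ q @ b" and q: "last p \<in> set q" "\<forall>v \<in> set q. P v"
      by (auto simp: S_def sublist_def)
    have "b = []"
    proof (rule ccontr)
      assume "b \<noteq> []"
      then have "last p \<in> set b" using p by simp
      then show False using p q(1) assms(2) by auto
    qed
    then have "takeWhile P (rev p) = rev q @ takeWhile P (rev a)"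
      using p q(2) takeWhile_append2[of "rev q" P "rev a"] by simp
    then show ?thesis by simp
  qed
  show ?thesis
  proof (cases "P (last p)")
    case True
    have "p = rev (dropWhile P (rev p)) @ ?q0"
      by (metis rev_append rev_rev_ident takeWhile_dropWhile_id)
    then have "sublist ?q0 p" by (metis append_Nil2 sublist_appendI)
    moreover have "takeWhile P (rev p) = last p # takeWhile P (rev (butlast p))"
      using True assms(1) by (cases p rule: rev_cases) auto
    then have "last p \<in> set ?q0" by simp
    moreover have "\<forall>v \<in> set ?q0. P v" by (auto dest: set_takeWhileD)
    ultimately have q0: "?q0 \<in> S" by (simp add: S_def)
    \<comment> \<open>The rules for \<open>ARG_MAX\<close> take a strict bound, hence
      \<open>Suc\<close>.\<close>
    have b: "\<forall>q. q \<in> S \<longrightarrow> length q < Suc (length ?q0)" using bound by (simp add: less_Suc_eq_le)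
    have "(ARG_MAX length q. q \<in> S) \<in> S"
      by (rule arg_max_natI[where P = "\<lambda>q. q \<in> S", OF q0 b])
    then have "length (ARG_MAX length q. q \<in> S) \<le> length ?q0" by (rule bound)
    moreover have "length ?q0 \<le> length (ARG_MAX length q. q \<in> S)"
      by (rule arg_max_nat_le[where P = "\<lambda>q. q \<in> S", OF q0 b])
    ultimately show ?thesis using q0 by auto
  next
    case False
    then have "S = {}" by (auto simp: S_def)
    moreover have "takeWhile P (rev p) = []"
      using False assms(1) by (cases p rule: rev_cases) auto
    ultimately show ?thesis by simp
  qed
qed

section \<open>Existence of the binary tree and its vertex set\<close>

context rooted_forest
begin

text \<open>The vertices of the subtree of the binary tree rooted at \<open>v\<close>.\<close>

definition later_descendants :: "nat \<Rightarrow> nat set" where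
  "later_descendants v = {x. \<exists>w \<in> sibship v. v \<le> w \<and> (parent f)\<^sup>*\<^sup>* w x}"

lemma descendant_in_verts: "(parent f)\<^sup>*\<^sup>* w x \<Longrightarrow> w \<in> {1..n} \<Longrightarrow> x \<in> {1..n}"
  by (induction rule: rtranclp_induct) (auto dest: parentD(2))

lemma finite_later_descendants:
  assumes "v \<in> {1..n}"
  shows "finite (later_descendants v)"
proof (rule finite_subset)
  show "later_descendants v \<subseteq> {1..n}"
    unfolding later_descendants_def using descendant_in_verts sibship_subset[OF assms] by blast
qed simp

lemma later_descendants_left_child:
  assumes "v \<in> {1..n}" "left_child f v = Some w"
  shows "w \<in> {1..n}" "later_descendants w = {x. \<exists>u \<in> sibship v. v < u \<and> (parent f)\<^sup>*\<^sup>* u x}"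
proof -
  let ?N = "{w \<in> sibship v. v < w}"
  have ne: "?N \<noteq> {}" and w: "w = Min ?N"
    using left_child_eq[OF assms(1)] assms(2) by (auto split: if_splits)
  have fin: "finite ?N" using finite_sibship[OF assms(1)] by simp
  have wN: "w \<in> ?N" unfolding w by (rule Min_in[OF fin ne])
  then show "w \<in> {1..n}" using sibship_subset[OF assms(1)] by blast
  have "w \<le> u \<longleftrightarrow> v < u" if "u \<in> sibship v" for u
  proof
    assume "v < u"
    then show "w \<le> u" unfolding w using that fin by (intro Min_le) auto
  qed (use wN in auto)
  moreover have "sibship w = sibship v" using sibship_eq wN by blast
  ultimately show "later_descendants w = {x. \<exists>u \<in> sibship v. v < u \<and> (parent f)\<^sup>*\<^sup>* u x}"
    unfolding later_descendants_def by blast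
qed

lemma left_child_None_iff:
  assumes "v \<in> {1..n}"
  shows "left_child f v = None \<longleftrightarrow> (\<forall>u \<in> sibship v. \<not> v < u)"
  using left_child_eq[OF assms] by auto

lemma right_child_None_iff: "right_child f v = None \<longleftrightarrow> (\<forall>u. \<not> parent f v u)"
  using right_child_eq[of v] by auto

lemma right_child_Some_iff: "right_child f v = Some w \<longleftrightarrow> parent f v w \<and> eta f w = 1"
proof -
  let ?N = "{w. parent f v w}"
  have fin: "finite ?N" using parentD(2) by (auto intro: finite_subset[of _ "{1..n}"])
  have *: "parent f v w \<Longrightarrow> eta f w = 1 \<longleftrightarrow> w = Min ?N"
    using eta_eq_1_iff[of w] sibship_child[of v w] parentD(2)[of v w] by auto
  show ?thesis
  proof
    assume "right_child f v = Some w"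
    then have "?N \<noteq> {}" and w: "w = Min ?N" using right_child_eq[of v] by (auto split: if_splits)
    then have "w \<in> ?N" using fin Min_in by blast
    then show "parent f v w \<and> eta f w = 1" using * w by blast
  next
    assume "parent f v w \<and> eta f w = 1"
    then show "right_child f v = Some w" using * right_child_eq[of v] by auto
  qed
qed

lemma later_descendants_right_child:
  assumes "right_child f v = Some w"
  shows "w \<in> {1..n}" "later_descendants w = {x. \<exists>u. parent f v u \<and> (parent f)\<^sup>*\<^sup>* u x}"
proof -
  have w: "parent f v w" "eta f w = 1" using assms right_child_Some_iff by auto
  then show wV: "w \<in> {1..n}" using parentD(2) by blast
  have "w \<le> u" if "u \<in> sibship w" for u
    using that w(2) eta_eq_1_iff[OF wV] finite_sibship[OF wV] Min_le by metis
  then show "later_descendants w = {x. \<exists>u. parent f v u \<and> (parent f)\<^sup>*\<^sup>* u x}"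
    unfolding later_descendants_def using sibship_child[OF w(1)] by blast
qed

text \<open>The later descendants of \<open>v\<close> split into \<open>v\<close>, those below
  larger siblings (the left subtree) and the proper descendants of \<open>v\<close> (the right
  subtree). Both subtrees omit \<open>v\<close>, so their sizes decrease, and the disjointness of
  the three parts gives distinct labels.\<close>

lemma ex_bin_subtree:
  assumes "v \<in> {1..n}"
  shows "\<exists>t. bin_subtree f (Some v) t \<and> set_tree t = later_descendants v \<and> distinct (preorder t)"
  using assms
proof (induction "card (later_descendants v)" arbitrary: v rule: less_induct)
  case less
  let ?L = "{x. \<exists>u \<in> sibship v. v < u \<and> (parent f)\<^sup>*\<^sup>* u x}"
  let ?R = "{x. \<exists>u. parent f v u \<and> (parent f)\<^sup>*\<^sup>* u x}"
  have eq: "later_descendants v = insert v (?L \<union> ?R)"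
  proof -
    have "(parent f)\<^sup>*\<^sup>* v x \<longleftrightarrow> x = v \<or> x \<in> ?R" for x
      by (auto elim: converse_rtranclpE intro: converse_rtranclp_into_rtranclp)
    moreover have "x \<in> later_descendants v \<longleftrightarrow> (parent f)\<^sup>*\<^sup>* v x \<or> x \<in> ?L" for x
      unfolding later_descendants_def by (auto simp: le_less)
    ultimately show ?thesis by blast
  qed
  have vL: "v \<notin> ?L"
    using common_descendant[of _ v v] root_dist_sibship by fastforce
  have vR: "v \<notin> ?R"
    using root_dist_descendant[of _ v] parentD(4)[of v] by fastforce
  \<comment> \<open>A common element would lie below both \<open>v\<close> and a larger sibling
    \<open>u\<close>, which are at the same distance from the roots.\<close>
  have LR: "?L \<inter> ?R = {}"
  proof -
    have False if "u \<in> sibship v" "v < u" "(parent f)\<^sup>*\<^sup>* u x" "parent f v w" "(parent f)\<^sup>*\<^sup>* w x" for u w x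
      using common_descendant[of u x v] that root_dist_sibship[OF that(1)]
        converse_rtranclp_into_rtranclp[of "parent f" v w x] by simp
    then show ?thesis by blast
  qed
  have fin: "finite (later_descendants v)" using finite_later_descendants less.prems by blast
  have smaller: "card A < card (later_descendants v)" if "A = ?L \<or> A = ?R" for A
  proof (rule psubset_card_mono[OF fin])
    show "A \<subset> later_descendants v" using that eq vL vR by blast
  qed
  obtain l where l: "bin_subtree f (left_child f v) l" "set_tree l = ?L" "distinct (preorder l)"
  proof (cases "left_child f v")
    case None
    then have "?L = {}" using left_child_None_iff[OF less.prems] by auto
    then show ?thesis using that[of "\<langle>\<rangle>"] None bin_subtree.absent by simp
  next
    case (Some w)
    note w = later_descendants_left_child[OF less.prems Some]
    show ?thesis
      using less.hyps[of w] smaller[of ?L] w that Some by metis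
  qed
  obtain r where r: "bin_subtree f (right_child f v) r" "set_tree r = ?R" "distinct (preorder r)"
  proof (cases "right_child f v")
    case None
    then have "?R = {}" using right_child_None_iff by auto
    then show ?thesis using that[of "\<langle>\<rangle>"] None bin_subtree.absent by simp
  next
    case (Some w)
    note w = later_descendants_right_child[OF Some]
    show ?thesis
      using less.hyps[of w] smaller[of ?R] w that Some by metis
  qed
  have "bin_subtree f (Some v) \<langle>l, v, r\<rangle>" using l(1) r(1) by (rule bin_subtree.vertex)
  moreover have "set_tree \<langle>l, v, r\<rangle> = later_descendants v" using eq l(2) r(2) by simp
  moreover have "distinct (preorder \<langle>l, v, r\<rangle>)"
  proof -
    have "v \<notin> set_tree l" "v \<notin> set_tree r" "set_tree l \<inter> set_tree r = {}"
      using vL vR LR unfolding l(2) r(2) by blast+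
    then show ?thesis using l(3) r(3) by simp
  qed
  ultimately show ?case by blast
qed

lemma Min_roots:
  assumes "1 \<le> n"
  shows "Min (roots f) \<in> roots f" "r \<in> roots f \<and> eta f r = 1 \<longleftrightarrow> r = Min (roots f)"
proof -
  have "roots f \<noteq> {}" using ex1_root[of 1] assms by auto
  then show *: "Min (roots f) \<in> roots f" using finite_roots by simp
  have "eta f r = 1 \<longleftrightarrow> r = Min (roots f)" if "r \<in> roots f" for r
    using eta_eq_1_iff[of r] sibship_root[OF that] roots_subset that by auto
  then show "r \<in> roots f \<and> eta f r = 1 \<longleftrightarrow> r = Min (roots f)" using * by blast
qed

lemma bin_root_eq: "1 \<le> n \<Longrightarrow> bin_root f = Min (roots f)"
  unfolding bin_root_def using Min_roots(2) by simp

text \<open>All roots are siblings of the smallest one and not below it in label, so its later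
  descendants are all vertices.\<close>

lemma bin_tree:
  assumes "1 \<le> n"
  shows "bin_subtree f (Some (Min (roots f))) (bin_tree f)"
    "set_tree (bin_tree f) = {1..n}" "distinct (preorder (bin_tree f))"
proof -
  let ?r = "Min (roots f)"
  have r: "?r \<in> roots f" using Min_roots(1)[OF assms] .
  then have rV: "?r \<in> {1..n}" using roots_subset by blast
  obtain t where t: "bin_subtree f (Some ?r) t" "set_tree t = later_descendants ?r"
    "distinct (preorder t)"
    using ex_bin_subtree[OF rV] by blast
  have "bin_tree f = t"
    unfolding bin_tree_def bin_root_eq[OF assms] using t(1) bin_subtree_unique by blast
  moreover have "later_descendants ?r = {1..n}"
  proof
    show "later_descendants ?r \<subseteq> {1..n}"
      unfolding later_descendants_def using descendant_in_verts sibship_subset[OF rV] by blast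
    show "{1..n} \<subseteq> later_descendants ?r"
    proof
      fix v assume "v \<in> {1..n}"
      then obtain s where "s \<in> roots f" "(parent f)\<^sup>*\<^sup>* s v" using descendant_of_root by blast
      then show "v \<in> later_descendants ?r"
        unfolding later_descendants_def sibship_root[OF r] using finite_roots by auto
    qed
  qed
  ultimately show "bin_subtree f (Some (Min (roots f))) (bin_tree f)"
    "set_tree (bin_tree f) = {1..n}" "distinct (preorder (bin_tree f))"
    using t by auto
qed

section \<open>The right spine is the path of vertices of rank 1\<close>

lemma spine_path:
  assumes "bin_subtree f x t" "x = Some v" "v \<in> {1..n}"
  shows "\<exists>ps. spine t = v # ps \<and> successively (parent f) (v # ps) \<and> leaf f (last (v # ps))
    \<and> (\<forall>w \<in> set ps. eta f w = 1)"
  using assms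
proof (induction arbitrary: v rule: bin_subtree.induct)
  case (vertex u l r)
  then have [simp]: "u = v" by simp
  show ?case
  proof (cases "right_child f v")
    case None
    then have "r = \<langle>\<rangle>" using vertex.hyps(2) bin_subtree_Leaf_iff by simp
    moreover have "leaf f v" using None right_child_None_iff vertex.prems(2) by (auto simp: leaf_def verts)
    ultimately show ?thesis by simp
  next
    case (Some w)
    then have w: "parent f v w" "eta f w = 1" using right_child_Some_iff by auto
    then obtain ps where "spine r = w # ps \<and> successively (parent f) (w # ps) \<and> leaf f (last (w # ps))
        \<and> (\<forall>w \<in> set ps. eta f w = 1)"
      using vertex.IH(2)[of w] Some parentD(2)[OF w(1)] by auto
    then show ?thesis using w by simp
  qed
qed simp

text \<open>After each vertex the path must take the child of rank \<open>1\<close>, which is the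
  right child, and it can only stop at a leaf, where there is none. The rank of the top vertex does
  not enter.\<close>

lemma spine_path_unique:
  assumes "bin_subtree f x t" "x = Some v" "successively (parent f) (v # ps)"
    "leaf f (last (v # ps))" "\<forall>w \<in> set ps. eta f w = 1"
  shows "spine t = v # ps"
  using assms
proof (induction arbitrary: v ps rule: bin_subtree.induct)
  case (vertex u l r)
  then have [simp]: "u = v" by simp
  show ?case
  proof (cases ps)
    case Nil
    then have "right_child f v = None" using vertex.prems(3) right_child_None_iff by (simp add: leaf_def)
    then have "r = \<langle>\<rangle>" using vertex.hyps(2) bin_subtree_Leaf_iff by simp
    then show ?thesis using Nil by simp
  next
    case (Cons w qs)
    then have "right_child f v = Some w" using vertex.prems right_child_Some_iff by simp
    then have "spine r = w # qs" using vertex.IH(2)[of w qs] vertex.prems Cons by simp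
    then show ?thesis using Cons by simp
  qed
qed simp

text \<open>A path that has gone down cannot turn up again: the only way up leads to the vertex it
  came from.\<close>

lemma successively_parent:
  "parent f a b \<Longrightarrow> distinct (a # b # p) \<Longrightarrow> successively (adj f) (a # b # p) \<Longrightarrow>
    successively (parent f) (a # b # p)"
proof (induction p arbitrary: a b)
  case (Cons c p)
  have "\<not> parent f c b" using parent_unique[of a b c] Cons.prems by auto
  then have "parent f b c" using adj_cases[of b c] Cons.prems by simp
  then show ?case using Cons by simp
qed simp

text \<open>Gives existence and uniqueness for the description in \<open>P_path\<close>. Such a path
  starts at the smallest root, goes down first because a root has no parent, and then keeps going
  down.\<close>

lemma is_root_leaf_path_iff_spine:
  assumes "1 \<le> n"
  shows "is_root_leaf_path f p \<and> (\<forall>v \<in> set p. eta f v = 1) \<longleftrightarrow> p = spine (bin_tree f)"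
proof
  let ?r = "Min (roots f)"
  assume p: "is_root_leaf_path f p \<and> (\<forall>v \<in> set p. eta f v = 1)"
  then obtain ps where ps: "p = ?r # ps"
    using Min_roots(2)[OF assms] by (cases p) (auto simp: is_root_leaf_path_def)
  have "successively (parent f) p"
  proof (cases ps)
    case (Cons b qs)
    then have "parent f ?r b"
      using p ps adj_cases[of ?r b] not_parent_root[OF Min_roots(1)[OF assms]]
      by (simp add: is_root_leaf_path_def)
    then show ?thesis
      using p ps Cons successively_parent[of ?r b qs] by (simp add: is_root_leaf_path_def)
  qed (simp add: ps)
  then show "p = spine (bin_tree f)"
    using spine_path_unique[OF bin_tree(1)[OF assms], of ?r ps] p ps
    by (simp add: is_root_leaf_path_def)
next
  let ?r = "Min (roots f)"
  assume p: "p = spine (bin_tree f)"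
  have r: "?r \<in> roots f" "eta f ?r = 1" using Min_roots[OF assms] by blast+
  then have "?r \<in> {1..n}" using roots_subset by blast
  then obtain ps where ps: "p = ?r # ps" "successively (parent f) p" "leaf f (last p)"
      "\<forall>w \<in> set ps. eta f w = 1"
    using spine_path[OF bin_tree(1)[OF assms] refl] p by auto
  moreover have "distinct p" using p distinct_spine bin_tree(3)[OF assms] by simp
  moreover have "successively (adj f) p" using ps(2) by (rule successively_mono) (simp add: parent_def)
  ultimately show "is_root_leaf_path f p \<and> (\<forall>v \<in> set p. eta f v = 1)"
    using r by (auto simp: is_root_leaf_path_def)
qed

text \<open>A vertex of rank \<open>1\<close> is the least of its sibship, so it has a left child
  iff it has a sibling. The second conjunct decides the test in the recursion of
  \<open>tail_len\<close>: \<open>v\<close> is counted only if everything below it on the spine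
  qualifies.\<close>

lemma tail_len_eq_takeWhile:
  assumes "bin_subtree f x t" "\<forall>v \<in> set (spine t). v \<in> {1..n} \<and> eta f v = 1"
  defines "Q \<equiv> \<lambda>v. \<nexists>w. siblings f v w"
  shows "tail_len t = length (takeWhile Q (rev (spine t))) \<and>
    (tail_len t = size t \<longleftrightarrow> (\<forall>v \<in> set (spine t). Q v))"
  using assms(1,2)
proof (induction rule: bin_subtree.induct)
  case (vertex v l r)
  have v: "v \<in> {1..n}" "eta f v = 1" using vertex.prems by auto
  have "v \<le> w" if "w \<in> sibship v" for w
    using that v(2) eta_eq_1_iff[OF v(1)] finite_sibship[OF v(1)] Min_le by metis
  then have "left_child f v = None \<longleftrightarrow> Q v"
    unfolding left_child_None_iff[OF v(1)] Q_def siblings_iff by (auto simp: nat_less_le)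
  then have l: "l = \<langle>\<rangle> \<longleftrightarrow> Q v" using bin_subtree_Leaf_iff[OF vertex.hyps(1)] by simp
  have IH: "tail_len r = length (takeWhile Q (rev (spine r)))"
    "tail_len r = size r \<longleftrightarrow> (\<forall>v \<in> set (spine r). Q v)"
    using vertex.IH(2) vertex.prems by auto
  show ?case
  proof (cases "\<forall>v \<in> set (spine r). Q v")
    case True
    then have "takeWhile Q (rev (spine r) @ [v]) = rev (spine r) @ takeWhile Q [v]"
      and tw: "takeWhile Q (rev (spine r)) = rev (spine r)"
      using True takeWhile_append2[of "rev (spine r)" Q "[v]"] by (simp_all add: takeWhile_eq_all_conv)
    \<comment> \<open>In this case \<open>r\<close> is a bare chain to the right.\<close>
    moreover have "size r = length (spine r)" using IH True unfolding tw by simp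
    ultimately show ?thesis using True IH l by auto
  next
    case False
    then obtain u where u: "u \<in> set (spine r)" "\<not> Q u" by blast
    then have "takeWhile Q (rev (spine r) @ [v]) = takeWhile Q (rev (spine r))"
      by (intro takeWhile_append1[of u]) auto
    moreover have "tail_len r < size r" using IH(2) False tail_len_le_size[of r] by simp
    ultimately show ?thesis using False IH by auto
  qed
qed simp

text \<open>Excluding the root leaves the tail of the right subtree \<open>r\<close>. It has the
  same length as the tail of the whole tree, except when the latter also includes the root and thus
  all \<open>n\<close> vertices.\<close>

lemma length_longest_subpath:
  assumes "1 \<le> n"
  shows "length (longest_subpath f) = (if tail_len (bin_tree f) = n then n - 1 else tail_len (bin_tree f))"
proof -
  define t where "t = bin_tree f"
  let ?r = "Min (roots f)"
  let ?P = "\<lambda>v. v \<notin> roots f \<and> (\<nexists>w. siblings f v w)"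
  note bt = bin_tree[OF assms, folded t_def]
  have P_path: "P_path f = spine t"
    unfolding P_path_def is_root_leaf_path_iff_spine[OF assms] t_def by simp
  have eta: "\<forall>v \<in> set (spine t). eta f v = 1" and path: "is_root_leaf_path f (spine t)"
    using is_root_leaf_path_iff_spine[OF assms, of "spine t"] by (auto simp: t_def)
  obtain l r where t: "t = \<langle>l, ?r, r\<rangle>" and r: "bin_subtree f (right_child f ?r) r"
    using bt(1) by (auto elim: bin_subtree.cases)
  have n: "size t = n" using bt(2,3) distinct_card[of "preorder t"] by simp
  have rr: "?r \<in> roots f" using Min_roots(1)[OF assms] .
  have "length (longest_subpath f) = length (takeWhile ?P (rev (spine t)))"
    unfolding longest_subpath_def admissible_subpaths_def v_leaf_def P_path
    using path by (intro length_longest_sublist_to_last) (auto simp: is_root_leaf_path_def)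
  also have "takeWhile ?P (rev (spine t)) = takeWhile ?P (rev (spine r))"
    using rr takeWhile_tail[of ?P ?r "rev (spine r)" "[]"] by (simp add: t)
  also have "takeWhile ?P (rev (spine r)) = takeWhile (\<lambda>v. \<nexists>w. siblings f v w) (rev (spine r))"
  proof (rule takeWhile_cong)
    fix v assume v: "v \<in> set (rev (spine r))"
    \<comment> \<open>The only root of rank \<open>1\<close> is the start of the path, and the path
      does not return to it.\<close>
    have "v \<notin> roots f"
    proof
      assume "v \<in> roots f"
      then have "v = ?r" using Min_roots(2)[OF assms] eta v t by auto
      then show False using v path t by (simp add: is_root_leaf_path_def)
    qed
    then show "?P v = (\<nexists>w. siblings f v w)" by simp
  qed simp
  also have "length \<dots> = tail_len r"
  proof -
    have "\<forall>v \<in> set (spine r). v \<in> {1..n} \<and> eta f v = 1"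
      using eta set_spine_subset[of r] bt(2) unfolding t by auto
    then show ?thesis using tail_len_eq_takeWhile[OF r] by simp
  qed
  finally show ?thesis
    using n tail_len_le_size[of r] tail_len_le_size[of l] unfolding t_def[symmetric] t
    by auto
qed

end

theorem theorem4p13:
  fixes n k :: nat and f :: rforest
  assumes "1 \<le> n" and "1 \<le> k" and "k \<le> n"
    and "f \<in> RF n"
  shows "f \<in> RF_class n k \<longleftrightarrow> length (longest_subpath f) = n - k"
proof -
  interpret rooted_forest n f by unfold_locales fact
  let ?t = "bin_tree f"
  note bt = bin_tree[OF assms(1)]
  have n: "size ?t = n" using bt(2,3) distinct_card[of "preorder ?t"] by simp
  then have "?t \<noteq> \<langle>\<rangle>" using assms(1) by auto
  \<comment> \<open>For \<open>k = 1\<close> a sub-path of \<open>n - 1\<close> vertices must mean a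
    tail of length \<open>n\<close>; this excludes the other source, a tail of length
    \<open>n - 1\<close>.\<close>
  then have "tail_len ?t \<noteq> n - 1" using tail_len_neq_size_minus_one n by metis
  then show ?thesis
    using RF_class_iff[OF bt(3,2) assms(4,1,2,3)] length_longest_subpath[OF assms(1)] assms(1-3)
    by auto
qed

end
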